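(* Let $\mathbb{K}$ be an algebraically closed field of characteristic zero and let $X$ be an affine ind-variety over $\mathbb{K}$. Then there is a countable local basis for the topological algebra $\mathcal{O}(X)$.
   Context: All algebraic varieties are over $\mathbb{K}$. An ind-variety is a set $X$ together with an ascending filtration $X_0\subseteq X_1\subseteq X_2\subseteq\dots\subseteq X$ such that $X=\bigcup_{k}X_k$, each $X_k$ has the structure of an algebraic variety, and each inclusion $X_k\subseteq X_{k+1}$ is a closed immersion of algebraic varieties. An ind-variety is affine if it admits a filtration in which all $X_k$ are affine (two filtrations being identified if for each of them every term is contained, via a morphism of varieties, in some term of the other). For an affine ind-variety with such a filtration, the coordinate ring is $\mathcal{O}(X)=\varprojlim\mathcal{O}(X_k)$, the inverse limit along the (surjective) restriction maps $\mathcal{O}(X_{k})\to\mathcal{O}(X_m)$, $k\ge m$. It is a topological algebra with the inverse limit topology, each $\mathcal{O}(X_k)$ being discrete; thus the kernels of the projections $\mathcal{O}(X)\to\mathcal{O}(X_k)$ form a base of neighborhoods of $0$. A subset $B\subseteq\mathcal{O}(X)$ is called a local basis of $\mathcal{O}(X)$ if for every non-empty open subset $U\subseteq\mathcal{O}(X)$ there is an element $f\in U$ contained in the $\mathbb{K}$-linear span of $B$. "Countable" means finite or countably infinite. *)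

theory Defs
  imports
    "HOL-Analysis.Analysis"
    "HOL-Computational_Algebra.Computational_Algebra"
    "HOL-Library.Poly_Mapping"
    "HOL-Library.Function_Algebras"
begin

(* Multivariate polynomials over 'k: finitely supported maps from monomials (exponent
   vectors) to coefficients.  A point of n-space is an extensional function on {..<n}. *)

type_synonym 'k mpoly = "(nat \<Rightarrow>\<^sub>0 nat) \<Rightarrow>\<^sub>0 'k"

definition polys :: "nat \<Rightarrow> 'k::zero mpoly set" where
  "polys n = {p. \<forall>m\<in>Poly_Mapping.keys p. Poly_Mapping.keys m \<subseteq> {..<n}}"

definition eval_mpoly :: "'k::comm_semiring_1 mpoly \<Rightarrow> (nat \<Rightarrow> 'k) \<Rightarrow> 'k" where
  "eval_mpoly p x =
     (\<Sum>m\<in>Poly_Mapping.keys p. Poly_Mapping.lookup p m *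
        (\<Prod>i\<in>Poly_Mapping.keys m. x i ^ Poly_Mapping.lookup m i))"

definition affine_space :: "nat \<Rightarrow> (nat \<Rightarrow> 'k) set" where
  "affine_space n = {..<n} \<rightarrow>\<^sub>E UNIV"

definition algebraic_set :: "nat \<Rightarrow> (nat \<Rightarrow> 'k::comm_semiring_1) set \<Rightarrow> bool" where
  "algebraic_set n Z \<longleftrightarrow>
     (\<exists>S \<subseteq> polys n. Z = {x \<in> affine_space n. \<forall>p\<in>S. eval_mpoly p x = 0})"

(* A set of points together with its algebra of regular functions.  A function on X is
   represented by the total function that agrees with it on X and is 0 off X, so that
   sums and scalar multiples of functions on X are pointwise ones. *)

record ('a, 'k) fun_space =
  points :: "'a set"
  regular :: "('a \<Rightarrow> 'k) set"

definition restrict0 :: "'a set \<Rightarrow> ('a \<Rightarrow> 'k::zero) \<Rightarrow> 'a \<Rightarrow> 'k" where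
  "restrict0 X f = (\<lambda>x. if x \<in> X then f x else 0)"

definition algebraic_set_space ::
    "nat \<Rightarrow> (nat \<Rightarrow> 'k::comm_semiring_1) set \<Rightarrow> (nat \<Rightarrow> 'k, 'k) fun_space" where
  "algebraic_set_space n Z =
     \<lparr>points = Z, regular = (\<lambda>p. restrict0 Z (eval_mpoly p)) ` polys n\<rparr>"

definition is_morphism ::
    "('a \<Rightarrow> 'b) \<Rightarrow> ('a, 'k::zero) fun_space \<Rightarrow> ('b, 'k) fun_space \<Rightarrow> bool" where
  "is_morphism \<phi> V W \<longleftrightarrow>
     \<phi> ` points V \<subseteq> points W \<and>
     (\<forall>g\<in>regular W. restrict0 (points V) (g \<circ> \<phi>) \<in> regular V)"

definition is_isomorphism ::
    "('a \<Rightarrow> 'b) \<Rightarrow> ('a, 'k::zero) fun_space \<Rightarrow> ('b, 'k) fun_space \<Rightarrow> bool" where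
  "is_isomorphism \<phi> V W \<longleftrightarrow>
     bij_betw \<phi> (points V) (points W) \<and>
     is_morphism \<phi> V W \<and> is_morphism (inv_into (points V) \<phi>) W V"

(* Varieties are not required to be irreducible. *)

definition affine_variety :: "('a, 'k::comm_semiring_1) fun_space \<Rightarrow> bool" where
  "affine_variety V \<longleftrightarrow>
     (\<forall>f\<in>regular V. \<forall>x. x \<notin> points V \<longrightarrow> f x = 0) \<and>
     (\<exists>n Z \<phi>. algebraic_set n Z \<and> is_isomorphism \<phi> V (algebraic_set_space n Z))"

definition zariski_closed :: "('a, 'k::zero) fun_space \<Rightarrow> 'a set \<Rightarrow> bool" where
  "zariski_closed V C \<longleftrightarrow>
     (\<exists>S \<subseteq> regular V. C = {x \<in> points V. \<forall>f\<in>S. f x = 0})"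

definition subspace_on :: "('a, 'k::zero) fun_space \<Rightarrow> 'a set \<Rightarrow> ('a, 'k) fun_space" where
  "subspace_on V C = \<lparr>points = C, regular = restrict0 C ` regular V\<rparr>"

definition closed_immersion ::
    "('a \<Rightarrow> 'b) \<Rightarrow> ('a, 'k::zero) fun_space \<Rightarrow> ('b, 'k) fun_space \<Rightarrow> bool" where
  "closed_immersion \<phi> V W \<longleftrightarrow>
     zariski_closed W (\<phi> ` points V) \<and>
     is_isomorphism \<phi> V (subspace_on W (\<phi> ` points V))"

(* X is an affine ind-variety with V as a filtration by affine varieties. *)

definition affine_ind_variety ::
    "'a set \<Rightarrow> (nat \<Rightarrow> ('a, 'k::comm_semiring_1) fun_space) \<Rightarrow> bool" where
  "affine_ind_variety X V \<longleftrightarrow>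
     X = (\<Union>k. points (V k)) \<and>
     (\<forall>k. affine_variety (V k)) \<and>
     (\<forall>k. points (V k) \<subseteq> points (V (Suc k)) \<and> closed_immersion (\<lambda>x. x) (V k) (V (Suc k)))"

(* The inverse limit of the coordinate rings of the V k along restriction; an element is a
   compatible family, and the algebra operations are pointwise. *)

definition coordinate_ring ::
    "(nat \<Rightarrow> ('a, 'k::zero) fun_space) \<Rightarrow> (nat \<Rightarrow> 'a \<Rightarrow> 'k) set" where
  "coordinate_ring V =
     {f. (\<forall>k. f k \<in> regular (V k)) \<and> (\<forall>m k. m \<le> k \<longrightarrow> restrict0 (points (V m)) (f k) = f m)}"

definition coordinate_topology ::
    "(nat \<Rightarrow> ('a, 'k::zero) fun_space) \<Rightarrow> (nat \<Rightarrow> 'a \<Rightarrow> 'k) topology" where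
  "coordinate_topology V =
     subtopology (product_topology (\<lambda>k. discrete_topology (regular (V k))) UNIV)
       (coordinate_ring V)"

definition scale_family :: "'k::times \<Rightarrow> (nat \<Rightarrow> 'a \<Rightarrow> 'k) \<Rightarrow> nat \<Rightarrow> 'a \<Rightarrow> 'k" where
  "scale_family c f = (\<lambda>k x. c * f k x)"

lemma vector_space_scale_family:
  "vector_space (scale_family :: 'k::field \<Rightarrow> (nat \<Rightarrow> 'a \<Rightarrow> 'k) \<Rightarrow> nat \<Rightarrow> 'a \<Rightarrow> 'k)"
  by unfold_locales (auto simp: scale_family_def fun_eq_iff algebra_simps)

lemma topspace_coordinate_topology [simp]:
  "topspace (coordinate_topology V) = coordinate_ring V"
  by (auto simp: coordinate_topology_def coordinate_ring_def PiE_def)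

definition local_basis ::
    "(nat \<Rightarrow> ('a, 'k::field) fun_space) \<Rightarrow> (nat \<Rightarrow> 'a \<Rightarrow> 'k) set \<Rightarrow> bool" where
  "local_basis V B \<longleftrightarrow>
     B \<subseteq> coordinate_ring V \<and>
     (\<forall>U. openin (coordinate_topology V) U \<and> U \<noteq> {} \<longrightarrow>
        (\<exists>f\<in>U. f \<in> module.span scale_family B))"

end

(*
  Every coordinate ring O(X_k) is spanned over K by the countable set of (pullbacks of)
  monomials.  As the restriction maps O(X_{k+1}) -> O(X_k) are surjective, so are the
  projections O(X) -> O(X_k), and the monomials of every O(X_k) can be lifted to O(X).  The set
  B of all these lifts is countable, and span B maps onto each O(X_k).  A non-empty open set
  contains a full fibre of some projection O(X) -> O(X_k), hence meets span B.
*)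

theory Submission
  imports Defs
begin

section \<open>Pointwise linear structure on functions and on families\<close>

definition scale_fun :: "'k::times \<Rightarrow> ('a \<Rightarrow> 'k) \<Rightarrow> 'a \<Rightarrow> 'k" where
  "scale_fun c f = (\<lambda>x. c * f x)"

interpretation scale_fun: vector_space "scale_fun :: 'k::field \<Rightarrow> ('a \<Rightarrow> 'k) \<Rightarrow> 'a \<Rightarrow> 'k"
  by unfold_locales (auto simp: scale_fun_def fun_eq_iff algebra_simps)

interpretation scale_family:
  vector_space "scale_family :: 'k::field \<Rightarrow> (nat \<Rightarrow> 'a \<Rightarrow> 'k) \<Rightarrow> nat \<Rightarrow> 'a \<Rightarrow> 'k"
  by (rule vector_space_scale_family)

lemma restrict0_restrict0: "A \<subseteq> B \<Longrightarrow> restrict0 A (restrict0 B f) = restrict0 A f"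
  by (auto simp: restrict0_def fun_eq_iff)

lemma restrict0_eq_self: "(\<And>x. x \<notin> A \<Longrightarrow> f x = 0) \<Longrightarrow> restrict0 A f = f"
  by (auto simp: restrict0_def)

lemma restrict0_add: "restrict0 A (f + g) = restrict0 A f + restrict0 A (g :: 'a \<Rightarrow> 'k::monoid_add)"
  by (auto simp: restrict0_def)

lemma restrict0_scale_fun:
  "restrict0 A (scale_fun c f) = scale_fun c (restrict0 A (f :: 'a \<Rightarrow> 'k::mult_zero))"
  by (auto simp: restrict0_def scale_fun_def)

lemma sum_fun_apply: "(\<Sum>i\<in>A. f i) x = (\<Sum>i\<in>A. f i x :: 'b::comm_monoid_add)"
  by (induction A rule: infinite_finite_induct) auto

text \<open>Linearity of pullbacks, and of projections in the next lemma, lets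
  \<open>module_hom.span_image\<close> carry spanning sets along these maps.\<close>

lemma module_hom_pullback:
  "module_hom (scale_fun :: 'k::field \<Rightarrow> _) scale_fun (\<lambda>g. restrict0 A (g \<circ> \<phi>))"
  by unfold_locales (auto simp: scale_fun_def restrict0_def fun_eq_iff algebra_simps)

lemma module_hom_component:
  "module_hom (scale_family :: 'k::field \<Rightarrow> _) scale_fun (\<lambda>f. f k)"
  by unfold_locales (auto simp: scale_fun_def scale_family_def fun_eq_iff algebra_simps)


section \<open>Polynomial functions\<close>

definition eval_monomial :: "(nat \<Rightarrow>\<^sub>0 nat) \<Rightarrow> (nat \<Rightarrow> 'k::comm_semiring_1) \<Rightarrow> 'k" where
  "eval_monomial m x = (\<Prod>i\<in>Poly_Mapping.keys m. x i ^ Poly_Mapping.lookup m i)"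

text \<open>Monomials outside the support have coefficient 0. Enlarging the index set lets
  polynomials with different supports be compared over one common sum.\<close>

lemma eval_mpoly_superset:
  assumes "finite A" "Poly_Mapping.keys p \<subseteq> A"
  shows "eval_mpoly p x = (\<Sum>m\<in>A. Poly_Mapping.lookup p m * eval_monomial m x)"
  unfolding eval_mpoly_def eval_monomial_def
  using assms by (intro sum.mono_neutral_left) (auto simp: in_keys_iff)

lemma eval_mpoly_add: "eval_mpoly (p + q) = eval_mpoly p + eval_mpoly q"
proof
  fix x :: "nat \<Rightarrow> 'a"
  let ?A = "Poly_Mapping.keys p \<union> Poly_Mapping.keys q"
  have "Poly_Mapping.keys (p + q) \<subseteq> ?A"
    by (rule Poly_Mapping.keys_add)
  then show "eval_mpoly (p + q) x = (eval_mpoly p + eval_mpoly q) x"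
    by (simp add: eval_mpoly_superset[where A = ?A] lookup_add algebra_simps sum.distrib)
qed

text \<open>Only an inclusion, since multiplication by \<open>c\<close> can kill coefficients, for
  instance when \<open>c = 0\<close>.\<close>

lemma keys_map_mult_subset:
  "Poly_Mapping.keys (Poly_Mapping.map ((*) (c::'k::mult_zero)) p) \<subseteq> Poly_Mapping.keys p"
  by (auto simp: in_keys_iff Poly_Mapping.map.rep_eq when_def)

lemma eval_mpoly_map_mult:
  "eval_mpoly (Poly_Mapping.map ((*) c) p) = scale_fun c (eval_mpoly p)"
proof
  fix x :: "nat \<Rightarrow> 'a"
  show "eval_mpoly (Poly_Mapping.map ((*) c) p) x = scale_fun c (eval_mpoly p) x"
    using keys_map_mult_subset[of c p]
    by (simp add: eval_mpoly_superset[where A = "Poly_Mapping.keys p"] scale_fun_def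
        Poly_Mapping.map.rep_eq when_def sum_distrib_left mult.assoc in_keys_iff)
qed

lemma eval_mpoly_single: "eval_mpoly (Poly_Mapping.single m 1) = eval_monomial m"
  by (simp add: eval_mpoly_superset[where A = "{m}"] fun_eq_iff)

lemma subspace_regular_algebraic_set_space:
  "scale_fun.subspace (regular (algebraic_set_space n (Z :: (nat \<Rightarrow> 'k::field) set)))"
proof (rule scale_fun.subspaceI)
  have "(0 :: 'k mpoly) \<in> polys n" "restrict0 Z (eval_mpoly 0) = 0"
    by (auto simp: polys_def eval_mpoly_def restrict0_def)
  then show "0 \<in> regular (algebraic_set_space n Z)"
    by (force simp: algebraic_set_space_def)
next
  fix f g assume "f \<in> regular (algebraic_set_space n Z)" "g \<in> regular (algebraic_set_space n Z)"
  then obtain p q where pq: "p \<in> polys n" "q \<in> polys n"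
    and "f = restrict0 Z (eval_mpoly p)" "g = restrict0 Z (eval_mpoly q)"
    by (auto simp: algebraic_set_space_def)
  then have "f + g = restrict0 Z (eval_mpoly (p + q))"
    by (simp add: eval_mpoly_add restrict0_add)
  moreover have "p + q \<in> polys n"
    using pq Poly_Mapping.keys_add[of p q] by (auto simp: polys_def)
  ultimately show "f + g \<in> regular (algebraic_set_space n Z)"
    by (auto simp: algebraic_set_space_def)
next
  fix c f assume "f \<in> regular (algebraic_set_space n Z)"
  then obtain p where p: "p \<in> polys n" and "f = restrict0 Z (eval_mpoly p)"
    by (auto simp: algebraic_set_space_def)
  then have "scale_fun c f = restrict0 Z (eval_mpoly (Poly_Mapping.map ((*) c) p))"
    by (simp add: eval_mpoly_map_mult restrict0_scale_fun)
  moreover have "Poly_Mapping.map ((*) c) p \<in> polys n"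
    using p keys_map_mult_subset[of c p] by (auto simp: polys_def)
  ultimately show "scale_fun c f \<in> regular (algebraic_set_space n Z)"
    by (auto simp: algebraic_set_space_def)
qed

text \<open>A monomial in the first \<open>n\<close> variables is determined by the list of its
  \<open>n\<close> exponents, and there are only countably many lists of natural numbers.\<close>

lemma countable_monomials: "countable {m :: nat \<Rightarrow>\<^sub>0 nat. Poly_Mapping.keys m \<subseteq> {..<n}}"
proof -
  have "inj_on (\<lambda>m. map (Poly_Mapping.lookup m) [0..<n])
          {m :: nat \<Rightarrow>\<^sub>0 nat. Poly_Mapping.keys m \<subseteq> {..<n}}"
  proof (rule inj_onI, rule poly_mapping_eqI)
    fix m m' :: "nat \<Rightarrow>\<^sub>0 nat" and i
    assume "m \<in> {m. Poly_Mapping.keys m \<subseteq> {..<n}}" "m' \<in> {m. Poly_Mapping.keys m \<subseteq> {..<n}}"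
      and "map (Poly_Mapping.lookup m) [0..<n] = map (Poly_Mapping.lookup m') [0..<n]"
    then have "i < n \<longrightarrow> Poly_Mapping.lookup m i = Poly_Mapping.lookup m' i"
      and "\<not> i < n \<longrightarrow> i \<notin> Poly_Mapping.keys m \<and> i \<notin> Poly_Mapping.keys m'"
      by auto
    then show "Poly_Mapping.lookup m i = Poly_Mapping.lookup m' i"
      by (cases "i < n") (simp_all add: in_keys_iff)
  qed
  then show ?thesis
    by (rule countableI')
qed

text \<open>The monomials, restricted to \<open>Z\<close>, serve as \<open>E\<close>. They need not
  be linearly independent on \<open>Z\<close>; only spanning matters.\<close>

lemma regular_algebraic_set_space_span:
  fixes Z :: "(nat \<Rightarrow> 'k::field) set"
  shows "\<exists>E. countable E \<and> regular (algebraic_set_space n Z) = scale_fun.span E"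
proof (intro exI conjI)
  define M where "M = {m :: nat \<Rightarrow>\<^sub>0 nat. Poly_Mapping.keys m \<subseteq> {..<n}}"
  let ?E = "(\<lambda>m. restrict0 Z (eval_monomial m)) ` M"
  show "countable ?E"
    using countable_monomials by (simp add: M_def)
  show "regular (algebraic_set_space n Z) = scale_fun.span ?E"
  proof
    show "scale_fun.span ?E \<subseteq> regular (algebraic_set_space n Z)"
    proof (rule scale_fun.span_minimal[OF _ subspace_regular_algebraic_set_space], clarify)
      fix m assume "m \<in> M"
      then have "Poly_Mapping.single m 1 \<in> polys n"
        by (auto simp: M_def polys_def)
      then show "restrict0 Z (eval_monomial m) \<in> regular (algebraic_set_space n Z)"
        by (auto simp: algebraic_set_space_def simp flip: eval_mpoly_single)
    qed
    show "regular (algebraic_set_space n Z) \<subseteq> scale_fun.span ?E"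
    proof
      fix f assume "f \<in> regular (algebraic_set_space n Z)"
      then obtain p where p: "p \<in> polys n" and f: "f = restrict0 Z (eval_mpoly p)"
        by (auto simp: algebraic_set_space_def)
      have "f = (\<Sum>m\<in>Poly_Mapping.keys p.
                  scale_fun (Poly_Mapping.lookup p m) (restrict0 Z (eval_monomial m)))"
        unfolding f
        by (auto simp: fun_eq_iff restrict0_def scale_fun_def sum_fun_apply
            eval_mpoly_superset[where A = "Poly_Mapping.keys p"])
      also have "\<dots> \<in> scale_fun.span ?E"
        using p by (intro scale_fun.span_sum scale_fun.span_scale scale_fun.span_base)
          (auto simp: polys_def M_def)
      finally show "f \<in> scale_fun.span ?E" .
    qed
  qed
qed

text \<open>Pullback along an isomorphism with an algebraic set is linear and maps the regular
  functions there onto those of \<open>V\<close>, so it transports the countable spanning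
  set.\<close>

lemma affine_variety_regular_span:
  fixes V :: "('a, 'k::field) fun_space"
  assumes "affine_variety V"
  shows "\<exists>E. countable E \<and> regular V = scale_fun.span E"
proof -
  obtain n Z \<phi> where iso: "is_isomorphism \<phi> V (algebraic_set_space n Z)"
    and zero: "\<And>f x. f \<in> regular V \<Longrightarrow> x \<notin> points V \<Longrightarrow> f x = 0"
    using assms unfolding affine_variety_def by blast
  define W where "W = algebraic_set_space n Z"
  let ?pull = "\<lambda>g. restrict0 (points V) (g \<circ> \<phi>)"
  let ?psi = "inv_into (points V) \<phi>"
  have bij: "bij_betw \<phi> (points V) (points W)"
    and \<phi>: "\<And>g. g \<in> regular W \<Longrightarrow> ?pull g \<in> regular V"
    and psi: "\<And>f. f \<in> regular V \<Longrightarrow> restrict0 (points W) (f \<circ> ?psi) \<in> regular W"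
    using iso unfolding is_isomorphism_def is_morphism_def W_def by blast+
  \<comment> \<open>This is an equality of total functions: on \<open>points V\<close> the two maps
    cancel, and off it both sides are 0, by \<open>zero\<close> for \<open>f\<close>.\<close>
  have pull_psi: "f = ?pull (restrict0 (points W) (f \<circ> ?psi))" if "f \<in> regular V" for f
    using zero[OF that] bij_betw_inv_into_left[OF bij] bij_betwE[OF bij]
    by (auto simp: restrict0_def fun_eq_iff)
  have "regular V = ?pull ` regular W"
  proof
    show "regular V \<subseteq> ?pull ` regular W"
    proof
      fix f assume f: "f \<in> regular V"
      show "f \<in> ?pull ` regular W"
        using pull_psi[OF f] psi[OF f] by (rule image_eqI)
    qed
    show "?pull ` regular W \<subseteq> regular V"
      using \<phi> by (rule image_subsetI)
  qed
  moreover obtain E where "countable E" "regular W = scale_fun.span E"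
    using regular_algebraic_set_space_span[of n Z] unfolding W_def by (elim exE conjE)
  ultimately have "countable (?pull ` E)" "regular V = scale_fun.span (?pull ` E)"
    by (simp_all add: module_hom.span_image[OF module_hom_pullback])
  then show ?thesis
    by blast
qed


section \<open>The coordinate ring of an affine ind-variety\<close>

context
  fixes X :: "'a set" and V :: "nat \<Rightarrow> ('a, 'k::field) fun_space"
  assumes ind_variety: "affine_ind_variety X V"
begin

section \<open>Restriction between the levels of the filtration\<close>

lemma affine_variety: "affine_variety (V k)"
  using ind_variety by (simp add: affine_ind_variety_def)

lemma points_mono: "m \<le> k \<Longrightarrow> points (V m) \<subseteq> points (V k)"
proof (rule lift_Suc_mono_le)
  show "points (V k) \<subseteq> points (V (Suc k))" for k
    using ind_variety by (simp add: affine_ind_variety_def)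
qed

lemma regular_eq_0: "f \<in> regular (V k) \<Longrightarrow> x \<notin> points (V k) \<Longrightarrow> f x = 0"
  using affine_variety[of k] by (simp add: affine_variety_def)

lemma restrict0_points: "f \<in> regular (V k) \<Longrightarrow> restrict0 (points (V k)) f = f"
  by (rule restrict0_eq_self, erule regular_eq_0)

text \<open>The closed immersion makes the identity an isomorphism onto the induced subspace. That
  it is a morphism gives one inclusion; that its inverse is one gives the other, which is the
  surjectivity of restriction.\<close>

lemma regular_Suc: "restrict0 (points (V k)) ` regular (V (Suc k)) = regular (V k)"
proof -
  let ?P = "points (V k)"
  have iso: "is_isomorphism (\<lambda>x. x) (V k) (subspace_on (V (Suc k)) ?P)"
    using ind_variety by (simp add: affine_ind_variety_def closed_immersion_def)
  \<comment> \<open>One restriction comes from \<open>subspace_on\<close>, the other from the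
    pullback in \<open>is_morphism\<close>.\<close>
  have 1: "restrict0 ?P (restrict0 ?P f) \<in> regular (V k)" if "f \<in> regular (V (Suc k))" for f
    using iso that by (auto simp: is_isomorphism_def is_morphism_def subspace_on_def o_def)
  have 2: "restrict0 ?P (g \<circ> inv_into ?P (\<lambda>x. x)) \<in> restrict0 ?P ` regular (V (Suc k))"
    if "g \<in> regular (V k)" for g
    using iso that by (auto simp: is_isomorphism_def is_morphism_def subspace_on_def)
  have 3: "restrict0 ?P (g \<circ> inv_into ?P (\<lambda>x. x)) = g" if "g \<in> regular (V k)" for g
    using regular_eq_0[OF that] inv_into_f_f[of "\<lambda>x. x" ?P]
    by (auto simp: restrict0_def fun_eq_iff)
  show ?thesis
  proof
    show "restrict0 ?P ` regular (V (Suc k)) \<subseteq> regular (V k)"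
      using 1 by (auto simp: restrict0_restrict0)
    show "regular (V k) \<subseteq> restrict0 ?P ` regular (V (Suc k))"
    proof
      fix g assume "g \<in> regular (V k)"
      then show "g \<in> restrict0 ?P ` regular (V (Suc k))"
        using 2[of g] by (simp add: 3)
    qed
  qed
qed

lemma restrict0_regular:
  assumes "m \<le> k" "f \<in> regular (V k)"
  shows "restrict0 (points (V m)) f \<in> regular (V m)"
  using assms
proof (induction k arbitrary: f rule: dec_induct)
  case base
  then show ?case
    by (simp add: restrict0_points)
next
  case (step k)
  have "restrict0 (points (V k)) f \<in> regular (V k)"
    using imageI[OF step.prems, of "restrict0 (points (V k))"] by (simp add: regular_Suc)
  then have "restrict0 (points (V m)) (restrict0 (points (V k)) f) \<in> regular (V m)"
    by (rule step.IH)
  then show ?case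
    using points_mono[OF step.hyps(1)] by (simp add: restrict0_restrict0)
qed

text \<open>Above level \<open>k\<close>, extensions of \<open>g\<close> are chosen one level at a
  time by surjectivity of restriction; below level \<open>k\<close>, restriction leaves no
  choice.\<close>

lemma coordinate_ring_lift:
  assumes "g \<in> regular (V k)"
  shows "\<exists>f\<in>coordinate_ring V. f k = g"
proof -
  \<comment> \<open>The index is shifted: \<open>h j\<close> lives on level \<open>k + j\<close>.
    The clause for \<open>j = 0\<close> makes the chain of choices start at
    \<open>g\<close>.\<close>
  have "\<exists>h. \<forall>j. (h j \<in> regular (V (k + j)) \<and> (j = 0 \<longrightarrow> h j = g)) \<and>
      restrict0 (points (V (k + j))) (h (Suc j)) = h j"
  proof (rule dependent_nat_choice
      [where P = "\<lambda>j f. f \<in> regular (V (k + j)) \<and> (j = 0 \<longrightarrow> f = g)"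
         and Q = "\<lambda>j f f'. restrict0 (points (V (k + j))) f' = f"])
    fix f j assume "f \<in> regular (V (k + j)) \<and> (j = 0 \<longrightarrow> f = g)"
    then have "f \<in> restrict0 (points (V (k + j))) ` regular (V (Suc (k + j)))"
      by (simp add: regular_Suc)
    then show "\<exists>f'. (f' \<in> regular (V (k + Suc j)) \<and> (Suc j = 0 \<longrightarrow> f' = g)) \<and>
        restrict0 (points (V (k + j))) f' = f"
      by auto
  qed (use assms in auto)
  then obtain h where h_choice: "\<forall>j. (h j \<in> regular (V (k + j)) \<and> (j = 0 \<longrightarrow> h j = g)) \<and>
      restrict0 (points (V (k + j))) (h (Suc j)) = h j"
    by (rule exE)
  then have h: "\<And>j. h j \<in> regular (V (k + j))" "h 0 = g"
    "\<And>j. restrict0 (points (V (k + j))) (h (Suc j)) = h j"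
    by simp_all
  have restrict_h: "restrict0 (points (V (k + i))) (h j) = h i" if "i \<le> j" for i j
    using that
  proof (induction j rule: dec_induct)
    case base
    then show ?case
      by (rule restrict0_points[OF h(1)])
  next
    case (step j)
    have "restrict0 (points (V (k + i))) (h (Suc j)) = restrict0 (points (V (k + i))) (h j)"
      using restrict0_restrict0[OF points_mono[of "k + i" "k + j"], of "h (Suc j)"] step(1)
      by (simp add: h(3))
    then show ?case
      using step by simp
  qed
  have restrict_h': "restrict0 (points (V m)) (h j) = restrict0 (points (V m)) (h i)"
    if "m \<le> k + i" "i \<le> j" for i j m
    using restrict0_restrict0[OF points_mono[OF that(1)], of "h j"]
    by (simp add: restrict_h[OF that(2)])
  \<comment> \<open>Since \<open>h m\<close> lives on level \<open>k + m\<close>, it is defined on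
    all of \<open>V m\<close>; this avoids a case split on whether \<open>m\<close> is below
    \<open>k\<close>. By \<open>restrict_h'\<close>, any later \<open>h j\<close> would give the
    same restriction.\<close>
  define f where "f = (\<lambda>m. restrict0 (points (V m)) (h m))"
  have "f m \<in> regular (V m)" for m
    unfolding f_def using h(1) by (intro restrict0_regular[of m "k + m"]) auto
  moreover have "restrict0 (points (V m)) (f j) = f m" if "m \<le> j" for m j
    using points_mono[OF that] restrict_h'[of m m j] that
    by (simp add: f_def restrict0_restrict0)
  moreover have "f k = g"
    using restrict_h[of 0 k] by (simp add: f_def h(2))
  ultimately show ?thesis
    by (auto simp: coordinate_ring_def)
qed

section \<open>Linear and topological structure of the inverse limit\<close>

lemma subspace_coordinate_ring: "scale_family.subspace (coordinate_ring V)"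
proof -
  have sub: "scale_fun.subspace (regular (V k))" for k
    using affine_variety_regular_span[OF affine_variety[of k]] scale_fun.subspace_span by metis
  show ?thesis
  proof (rule scale_family.subspaceI)
    show "0 \<in> coordinate_ring V"
      using scale_fun.subspace_0[OF sub]
      by (auto simp: coordinate_ring_def restrict0_def)
    show "f + g \<in> coordinate_ring V" if "f \<in> coordinate_ring V" "g \<in> coordinate_ring V" for f g
      using that scale_fun.subspace_add[OF sub]
      by (auto simp: coordinate_ring_def restrict0_add)
    show "scale_family c f \<in> coordinate_ring V" if "f \<in> coordinate_ring V" for c f
    proof -
      have "scale_family c f k = scale_fun c (f k)" for k
        by (simp add: scale_family_def scale_fun_def)
      then show ?thesis
        using that scale_fun.subspace_scale[OF sub]
        by (auto simp: coordinate_ring_def restrict0_scale_fun)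
    qed
  qed
qed

text \<open>A basic open set of the product constrains only finitely many components. In a
  compatible family the component at the largest such index determines all earlier ones, so a single
  \<open>k\<close> suffices.\<close>

lemma openin_coordinate_topology_fibre:
  assumes "openin (coordinate_topology V) U" "u \<in> U"
  shows "\<exists>k. \<forall>f\<in>coordinate_ring V. f k = u k \<longrightarrow> f \<in> U"
proof -
  obtain T where T: "openin (product_topology (\<lambda>k. discrete_topology (regular (V k))) UNIV) T"
    and U: "U = T \<inter> coordinate_ring V"
    using assms(1) unfolding coordinate_topology_def openin_subtopology by blast
  have u: "u \<in> T" "u \<in> coordinate_ring V"
    using assms(2) U by auto
  obtain S where S: "finite {i. S i \<noteq> regular (V i)}" "u \<in> Pi\<^sub>E UNIV S" "Pi\<^sub>E UNIV S \<subseteq> T"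
    using T u(1) unfolding openin_product_topology_alt by fastforce
  \<comment> \<open>Beyond \<open>k\<close> the box \<open>S\<close> imposes nothing more than
    regularity, which every element of the coordinate ring satisfies.\<close>
  obtain k where k: "\<And>i. S i \<noteq> regular (V i) \<Longrightarrow> i \<le> k"
    using S(1) unfolding finite_nat_set_iff_bounded_le by blast
  have "f \<in> U" if f: "f \<in> coordinate_ring V" "f k = u k" for f
  proof -
    have "f i \<in> S i" for i
    proof (cases "i \<le> k")
      case True
      then have "f i = u i"
        using f u(2) by (auto simp: coordinate_ring_def) metis
      then show ?thesis
        using S(2) by auto
    next
      case False
      then show ?thesis
        using k[of i] f(1) by (auto simp: coordinate_ring_def)
    qed
    then show ?thesis
      using S(3) U f(1) by (auto simp: PiE_def)
  qed
  then show ?thesis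
    by blast
qed

text \<open>Density is reduced to surjectivity level by level: \<open>U\<close> contains a whole
  fibre of one projection, and \<open>span B\<close> meets every fibre.\<close>

lemma local_basis_if_projections_onto:
  assumes B: "B \<subseteq> coordinate_ring V"
    and onto: "\<And>k. regular (V k) \<subseteq> (\<lambda>f. f k) ` scale_family.span B"
  shows "local_basis V B"
  unfolding local_basis_def
proof (intro conjI allI impI)
  fix U assume U: "openin (coordinate_topology V) U \<and> U \<noteq> {}"
  then obtain u where u: "u \<in> U"
    by blast
  then obtain k where k: "\<And>f. f \<in> coordinate_ring V \<Longrightarrow> f k = u k \<Longrightarrow> f \<in> U"
    using openin_coordinate_topology_fibre[of U u] U by metis
  have "u k \<in> regular (V k)"
    using U u openin_subset by (fastforce simp: coordinate_ring_def)
  then obtain f where f: "f \<in> scale_family.span B" "f k = u k"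
    using onto[of k] by force
  \<comment> \<open>The fibre description of \<open>U\<close> covers only compatible families, so
    the span must stay inside the coordinate ring.\<close>
  have "f \<in> coordinate_ring V"
    using f(1) scale_family.span_minimal[OF B subspace_coordinate_ring] by blast
  then show "\<exists>f\<in>U. f \<in> scale_family.span B"
    using f k by blast
qed (rule B)

lemma countable_local_basis: "\<exists>B. countable B \<and> local_basis V B"
proof -
  have "\<forall>k. \<exists>E. countable E \<and> regular (V k) = scale_fun.span E"
    by (intro allI affine_variety_regular_span affine_variety)
  then obtain E where E: "\<And>k. countable (E k)" "\<And>k. regular (V k) = scale_fun.span (E k)"
    by metis
  \<comment> \<open>A chosen lift of \<open>e\<close> from level \<open>k\<close>; its value is
    meaningful only when a lift exists, in particular for \<open>e\<close> in
    \<open>E k\<close>.\<close>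
  define F where "F k e = (SOME f. f \<in> coordinate_ring V \<and> f k = e)" for k e
  have F: "F k e \<in> coordinate_ring V \<and> F k e k = e" if "e \<in> E k" for k e
  proof -
    have "e \<in> regular (V k)"
      using that by (simp add: E(2) scale_fun.span_base)
    then have "\<exists>f. f \<in> coordinate_ring V \<and> f k = e"
      using coordinate_ring_lift[of e k] by (simp add: Bex_def)
    then show ?thesis
      unfolding F_def by (rule someI_ex)
  qed
  define B where "B = (\<Union>k. F k ` E k)"
  have "regular (V k) \<subseteq> (\<lambda>f. f k) ` scale_family.span B" for k
  proof -
    \<comment> \<open>Projecting the lifts recovers the spanning set, and a linear projection
      commutes with spans; the lifts from level \<open>k\<close> alone already reach all of
      \<open>regular (V k)\<close>.\<close>
    have "(\<lambda>f. f k) ` F k ` E k = E k"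
      using F by (simp add: image_image)
    then have "regular (V k) = (\<lambda>f. f k) ` scale_family.span (F k ` E k)"
      using module_hom.span_image[OF module_hom_component, of k "F k ` E k"] by (simp add: E(2))
    also have "\<dots> \<subseteq> (\<lambda>f. f k) ` scale_family.span B"
      by (intro image_mono scale_family.span_mono) (auto simp: B_def)
    finally show ?thesis .
  qed
  moreover have "B \<subseteq> coordinate_ring V" "countable B"
    using F E(1) by (auto simp: B_def)
  ultimately show ?thesis
    using local_basis_if_projections_onto by blast
qed

end

theorem theorem2:
  fixes X :: "'a set"
    and V :: "nat \<Rightarrow> ('a, 'k::{alg_closed_field, field_char_0}) fun_space"
  assumes "affine_ind_variety X V"
  shows "\<exists>B. countable B \<and> local_basis V B"
  using assms by (rule countable_local_basis)

end
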